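(* Let $K\subset[0,1]$ be the attractor of a homogeneous linear iterated function system $\{\phi_j(x)=\rho x+a_j\}_{j=1}^L$ satisfying the strong separation condition, let $\mu$ be the natural self-similar probability measure on $K$, let $T:K\to K$ be the map induced by the shift, and let $\gamma:=\dim_H K=\frac{\log L}{-\log\rho}$. Let $\varphi:\mathbb{N}\to\mathbb{R}^+$ be any positive function and set $$R(\varphi):=\{x\in K:\ |T^n x-x|<\varphi(n)\ \text{for infinitely many } n\in\mathbb{N}\}.$$ Then $$\mu(R(\varphi))=\begin{cases}0, & \text{if } \sum_{n\ge1}\varphi(n)^{\gamma}<\infty;\\ 1, & \text{if } \sum_{n\ge1}\varphi(n)^{\gamma}=\infty.\end{cases}$$
   Context: Setting. Let $L\ge 2$ be an integer, $\rho\in(0,1)$, and $0\le a_1<\cdots<a_L\le 1-\rho$. Put $\phi_j(x)=\rho x+a_j$ on $[0,1]$ for $1\le j\le L$. The attractor $K$ is the unique non-empty compact subset of $[0,1]$ with $K=\bigcup_{j=1}^L\phi_j(K)$. The strong separation condition means that the sets $\phi_1(K),\dots,\phi_L(K)$ are pairwise disjoint (as a consequence $\rho<1/L$). Coding. Let $\Lambda=\{1,\dots,L\}$. For $\epsilon=(\epsilon_1,\epsilon_2,\dots)\in\Lambda^{\mathbb{N}}$ let $\pi(\epsilon)$ be the unique point of $\bigcap_{n\ge1}\phi_{\epsilon_1}\circ\cdots\circ\phi_{\epsilon_n}([0,1])$. Then $K=\pi(\Lambda^{\mathbb{N}})$, and each $x\in K$ has a unique coding, i.e. a unique $\epsilon$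 with $\pi(\epsilon)=x$. Map. $T:K\to K$ is defined by $Tx=\pi(\sigma(\epsilon))$ where $\epsilon$ is the coding of $x$ and $\sigma$ is the left shift on $\Lambda^{\mathbb{N}}$. Measure. $\mu$ is the unique Borel probability measure supported on $K$ with $\mu(A)=\frac1L\sum_{j=1}^L\mu(\phi_j^{-1}(A))$ for all Borel $A$. Here $\dim_H$ is Hausdorff dimension, $|\cdot|$ is the Euclidean metric, $\mathbb{N}=\{1,2,\dots\}$, and $\mathbb{R}^+=(0,\infty)$. *)

theory Defs
  imports "HOL-Probability.Probability"
begin

definition ifs_map :: "real \<Rightarrow> (nat \<Rightarrow> real) \<Rightarrow> nat \<Rightarrow> real \<Rightarrow> real" where
  "ifs_map \<rho> a j x = \<rho> * x + a j"

definition is_attractor :: "nat \<Rightarrow> real \<Rightarrow> (nat \<Rightarrow> real) \<Rightarrow> real set \<Rightarrow> bool" where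
  "is_attractor L \<rho> a K \<longleftrightarrow>
     K \<noteq> {} \<and> compact K \<and> K \<subseteq> {0..1} \<and> K = (\<Union>j\<in>{1..L}. ifs_map \<rho> a j ` K)"

definition strong_separation :: "nat \<Rightarrow> real \<Rightarrow> (nat \<Rightarrow> real) \<Rightarrow> real set \<Rightarrow> bool" where
  "strong_separation L \<rho> a K \<longleftrightarrow> disjoint_family_on (\<lambda>j. ifs_map \<rho> a j ` K) {1..L}"

text \<open>Elements of the sequence space are indexed from 0: the letter written
  \<open>\<epsilon>\<close> with subscript \<open>i + 1\<close> on paper is \<open>\<epsilon> i\<close>, so
  \<open>ifs_comp \<rho> a \<epsilon> n\<close> composes the maps of the first \<open>n\<close> letters,
  the first letter outermost.\<close>

definition code_space :: "nat \<Rightarrow> (nat \<Rightarrow> nat) set" where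
  "code_space L = {\<epsilon>. \<forall>i. \<epsilon> i \<in> {1..L}}"

primrec ifs_comp :: "real \<Rightarrow> (nat \<Rightarrow> real) \<Rightarrow> (nat \<Rightarrow> nat) \<Rightarrow> nat \<Rightarrow> real \<Rightarrow> real" where
  "ifs_comp \<rho> a \<epsilon> 0 = id"
| "ifs_comp \<rho> a \<epsilon> (Suc n) = ifs_comp \<rho> a \<epsilon> n \<circ> ifs_map \<rho> a (\<epsilon> n)"

definition code_proj :: "real \<Rightarrow> (nat \<Rightarrow> real) \<Rightarrow> (nat \<Rightarrow> nat) \<Rightarrow> real" where
  "code_proj \<rho> a \<epsilon> = (THE x. x \<in> (\<Inter>n\<in>{1..}. ifs_comp \<rho> a \<epsilon> n ` {0..1}))"

definition coding :: "nat \<Rightarrow> real \<Rightarrow> (nat \<Rightarrow> real) \<Rightarrow> real \<Rightarrow> (nat \<Rightarrow> nat)" where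
  "coding L \<rho> a x = (THE \<epsilon>. \<epsilon> \<in> code_space L \<and> code_proj \<rho> a \<epsilon> = x)"

definition left_shift :: "(nat \<Rightarrow> nat) \<Rightarrow> (nat \<Rightarrow> nat)" where
  "left_shift \<epsilon> = (\<lambda>i. \<epsilon> (Suc i))"

text \<open>Under the strong separation condition this is a self-map of the attractor;
  its values elsewhere carry no meaning.\<close>

definition shift_map :: "nat \<Rightarrow> real \<Rightarrow> (nat \<Rightarrow> real) \<Rightarrow> real \<Rightarrow> real" where
  "shift_map L \<rho> a x = code_proj \<rho> a (left_shift (coding L \<rho> a x))"

text \<open>The maps of the system have domain \<open>[0,1]\<close>, hence the intersection in the preimage.\<close>

definition is_self_similar_measure ::
  "nat \<Rightarrow> real \<Rightarrow> (nat \<Rightarrow> real) \<Rightarrow> real set \<Rightarrow> real measure \<Rightarrow> bool" where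
  "is_self_similar_measure L \<rho> a K \<mu> \<longleftrightarrow>
     prob_space \<mu> \<and> sets \<mu> = sets borel \<and> measure \<mu> (- K) = 0 \<and>
     (\<forall>A\<in>sets borel.
        measure \<mu> A = 1 / real L * (\<Sum>j=1..L. measure \<mu> (ifs_map \<rho> a j -` A \<inter> {0..1})))"

definition recurrence_set ::
  "nat \<Rightarrow> real \<Rightarrow> (nat \<Rightarrow> real) \<Rightarrow> real set \<Rightarrow> (nat \<Rightarrow> real) \<Rightarrow> real set" where
  "recurrence_set L \<rho> a K \<phi> =
     {x \<in> K. infinite {n. 1 \<le> n \<and> \<bar>(shift_map L \<rho> a ^^ n) x - x\<bar> < \<phi> n}}"

text \<open>Hausdorff measure and dimension. The \<open>s\<close>-th power of the diameter is taken with the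
  usual conventions that the empty set contributes 0 and that \<open>0\<close> to the power \<open>0\<close> is 1
  for nonempty sets (whereas \<open>0 powr 0 = 0\<close>). Covering sets are required to be bounded
  because \<open>diameter\<close> is meaningless on unbounded sets.\<close>

definition diam_pow :: "real \<Rightarrow> 'a::metric_space set \<Rightarrow> ennreal" where
  "diam_pow s U = (if U = {} then 0 else if s = 0 then 1 else ennreal (diameter U powr s))"

definition hausdorff_premeasure :: "real \<Rightarrow> real \<Rightarrow> 'a::metric_space set \<Rightarrow> ennreal" where
  "hausdorff_premeasure s \<delta> A =
     (INF U \<in> {U :: nat \<Rightarrow> 'a set. A \<subseteq> (\<Union>i. U i) \<and> (\<forall>i. bounded (U i) \<and> diameter (U i) \<le> \<delta>)}.
        (\<Sum>i. diam_pow s (U i)))"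

definition hausdorff_measure :: "real \<Rightarrow> 'a::metric_space set \<Rightarrow> ennreal" where
  "hausdorff_measure s A = (SUP \<delta> \<in> {0<..}. hausdorff_premeasure s \<delta> A)"

text \<open>Restricted to Euclidean spaces, where the set below is never empty (it contains every
  exponent exceeding the dimension of the space), so that the infimum is a real number.\<close>

definition hausdorff_dim :: "'a::euclidean_space set \<Rightarrow> real" where
  "hausdorff_dim A = Inf {s. 0 \<le> s \<and> hausdorff_measure s A = 0}"

end

theory Submission
  imports Defs
begin

text \<open>
  Everything happens on codes. If the codes of two points of the attractor agree in their first
  \<open>k\<close> letters and no further, the points are at a distance comparable to \<open>\<rho> ^ k\<close>: at most \<open>\<rho> ^ k\<close>
  because both lie in one cylinder (\<open>addr_dist_le\<close>), and at least a constant multiple of it because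
  distinct first-level pieces are a positive distance apart (\<open>addr_dist_ge\<close>). Hence
  \<open>\<bar>T\<^sup>n x - x\<bar> < r\<close> says, up to replacing \<open>r\<close> by a constant multiple, that the code \<open>\<epsilon>\<close> of \<open>x\<close>
  satisfies \<open>\<epsilon> (n + i) = \<epsilon> i\<close> for all \<open>i < k\<close>, with \<open>k\<close> the first exponent such that \<open>\<rho> ^ k < r\<close>.
  Under the self-similar measure the letters are independent and uniform, so for \<open>n > 0\<close> this event
  \<open>matches n k\<close> has probability \<open>1 / L ^ k\<close>, which is \<open>(\<rho> ^ k) powr \<gamma>\<close> since \<open>\<rho> powr \<gamma> = 1 / L\<close>. The
  convergence half is therefore the first Borel-Cantelli lemma.

  For the divergence half, the key fact is that \<open>matches n p\<close> and \<open>matches m q\<close> are exactly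
  independent whenever \<open>0 < n < m\<close> and \<open>p \<le> n\<close>, even if the windows overlap: the graph on positions
  with edges \<open>{i, n + i}\<close> for \<open>i < p\<close> and \<open>{j, m + j}\<close> for \<open>j < q\<close> is a forest, and each edge of a
  forest costs one factor \<open>L\<close> (\<open>card_two_matches\<close>). Times \<open>n\<close> for which the required prefix is longer
  than \<open>n\<close> have \<open>\<phi> n powr \<gamma>\<close> geometrically small, so they can be dropped without affecting divergence.
  What remains is pairwise independent with divergent sum of probabilities, and the second
  Borel-Cantelli lemma, which by Chebyshev's inequality needs pairwise independence only
  (\<open>pairwise_borel_cantelli\<close>), gives full measure directly.

  The dimension is obtained from the same comparison of distances with common prefixes: covering
  by cylinders bounds it from above, and \<open>prob U \<le> c * diameter U powr \<gamma>\<close> (\<open>mass_bound\<close>) bounds it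
  from below.
\<close>

section \<open>The second Borel-Cantelli lemma under pairwise independence\<close>

text \<open>The number of the first \<open>N\<close> events that occur has variance at most its mean, since the
  covariances are nonpositive. When the mean tends to infinity, Chebyshev's inequality shows that
  the count stays below any fixed bound with probability zero.\<close>

lemma (in prob_space) pairwise_borel_cantelli:
  fixes B :: "nat \<Rightarrow> 'a set"
  assumes ev [measurable]: "\<And>n. B n \<in> events"
    and indep: "\<And>i j. i < j \<Longrightarrow> prob (B i \<inter> B j) \<le> prob (B i) * prob (B j)"
    and div: "\<not> summable (\<lambda>n. prob (B n))"
  shows "AE x in M. infinite {n. x \<in> B n}"
proof -
  define S :: "nat \<Rightarrow> 'a \<Rightarrow> real" where "S N x = (\<Sum>i<N. indicator (B i) x)" for N x
  define s where "s N = (\<Sum>i<N. prob (B i))" for N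
  have S_meas [measurable]: "S N \<in> borel_measurable M" for N
    unfolding S_def by measurable
  have s_unbounded: "\<exists>N. c < s N" for c
  proof (rule ccontr)
    assume "\<not> (\<exists>N. c < s N)"
    then have "s N \<le> c" for N by (meson not_less)
    then have "summable (\<lambda>n. prob (B n))"
      unfolding s_def by (intro summableI_nonneg_bounded[where x = c]) auto
    with div show False by blast
  qed
  have ind_int: "integrable M (indicat_real A)" if "A \<in> events" for A
    using that by (intro integrable_real_indicator) (auto simp: emeasure_eq_measure)
  have ES: "expectation (S N) = s N" for N
    unfolding S_def s_def by (subst Bochner_Integration.integral_sum) (auto intro!: ind_int simp: sets.Int_space_eq2)
  have sq: "(S N x)\<^sup>2 = (\<Sum>i<N. \<Sum>j<N. indicator (B i \<inter> B j) x)" for N x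
    unfolding S_def power2_eq_square sum_product by (simp add: indicator_inter_arith)
  have S2_int: "integrable M (\<lambda>x. (S N x)\<^sup>2)" for N
    unfolding sq by (intro Bochner_Integration.integrable_sum ind_int) measurable
  have S_int: "integrable M (S N)" for N
    unfolding S_def by (intro Bochner_Integration.integrable_sum ind_int) measurable
  have ES2: "expectation (\<lambda>x. (S N x)\<^sup>2) \<le> (s N)\<^sup>2 + s N" for N
  proof -
    have "expectation (\<lambda>x. (S N x)\<^sup>2) = (\<Sum>i<N. \<Sum>j<N. prob (B i \<inter> B j))"
      unfolding sq
      by (simp add: Bochner_Integration.integral_sum Bochner_Integration.integrable_sum ind_int sets.Int
        sets.Int_space_eq2)
    also have "\<dots> \<le> (\<Sum>i<N. \<Sum>j<N. prob (B i) * prob (B j) + (if j = i then prob (B i) else 0))"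
    proof (intro sum_mono)
      fix i j :: nat
      consider "i = j" | "i < j" | "j < i" by linarith
      then show "prob (B i \<inter> B j) \<le> prob (B i) * prob (B j) + (if j = i then prob (B i) else 0)"
        using indep[of i j] indep[of j i] by cases (auto simp: Int_commute mult.commute)
    qed
    also have "\<dots> = (s N)\<^sup>2 + s N"
      by (simp add: sum.distrib s_def power2_eq_square sum_product)
    finally show ?thesis .
  qed
  have var: "variance (S N) \<le> s N" for N
    using ES2[of N] by (subst variance_eq[OF S_int S2_int]) (simp add: ES)
  define G where "G j = {x \<in> space M. \<forall>N. S N x \<le> real j}" for j :: nat
  have G_ev [measurable]: "G j \<in> events" for j
    unfolding G_def by measurable
  have "prob (G j) \<le> e" if "0 < e" for j e
  proof -
    \<comment> \<open>large enough that \<open>s N - j\<close> exceeds half the mean and that \<open>4 / s N\<close> is at most \<open>e\<close>\<close>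
    obtain N where N: "s N > 2 * real j + 4 / e + 1" using s_unbounded by blast
    have "0 < 4 / e" using \<open>0 < e\<close> by simp
    with N have pos: "s N > 0" and half: "s N / 2 \<le> s N - j" by linarith+
    have "prob (G j) \<le> prob {x \<in> space M. s N / 2 \<le> \<bar>S N x - expectation (S N)\<bar>}"
    proof (intro finite_measure_mono subsetI)
      fix x assume "x \<in> G j"
      then have "x \<in> space M" "S N x \<le> real j" by (auto simp: G_def)
      with half show "x \<in> {x \<in> space M. s N / 2 \<le> \<bar>S N x - expectation (S N)\<bar>}"
        unfolding ES by simp
    qed measurable
    also have "\<dots> \<le> variance (S N) / (s N / 2)\<^sup>2"
      using pos by (intro Chebyshev_inequality S2_int) auto
    also have "\<dots> \<le> s N / (s N / 2)\<^sup>2"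
      using var by (intro divide_right_mono) auto
    also have "\<dots> = 4 / s N" using pos by (simp add: power2_eq_square)
    also have "\<dots> \<le> e"
    proof -
      have "4 / e \<le> s N" using N by simp
      then show ?thesis using \<open>0 < e\<close> pos by (simp add: field_simps)
    qed
    finally show ?thesis .
  qed
  then have "prob (G j) = 0" for j
    using field_le_epsilon[of "prob (G j)" 0] by (simp add: measure_le_0_iff)
  then have "G j \<in> null_sets M" for j
    using G_ev by (simp add: null_sets_def emeasure_eq_measure)
  then have "AE x in M. \<forall>j. x \<notin> G j"
    unfolding AE_all_countable using AE_not_in by blast
  then show ?thesis
  proof (rule AE_mp, intro AE_I2 impI)
    fix x assume x: "x \<in> space M" "\<forall>j. x \<notin> G j"
    show "infinite {n. x \<in> B n}"
    proof
      assume fin: "finite {n. x \<in> B n}"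
      have "S N x \<le> card {n. x \<in> B n}" for N
      proof -
        have "S N x = card ({..<N} \<inter> {n. x \<in> B n})"
          unfolding S_def indicator_def by (simp add: sum.If_cases)
        then show ?thesis using card_mono[OF fin, of "{..<N} \<inter> {n. x \<in> B n}"] by simp
      qed
      with x show False unfolding G_def by blast
    qed
  qed
qed

section \<open>Counting words with two prescribed repetitions\<close>

definition words :: "nat \<Rightarrow> nat \<Rightarrow> (nat \<Rightarrow> nat) set" where
  "words L N = (\<Pi>\<^sub>E i\<in>{..<N}. {1..L})"

definition matches :: "nat \<Rightarrow> nat \<Rightarrow> (nat \<Rightarrow> nat) \<Rightarrow> bool" where
  "matches n k \<epsilon> \<longleftrightarrow> (\<forall>i<k. \<epsilon> (n + i) = \<epsilon> i)"

lemma matches_Suc: "matches n (Suc k) \<epsilon> \<longleftrightarrow> matches n k \<epsilon> \<and> \<epsilon> (n + k) = \<epsilon> k"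
  by (auto simp: matches_def less_Suc_eq)

lemma finite_words: "finite (words L N)"
  by (simp add: words_def finite_PiE)

lemma card_words: "card (words L N) = L ^ N"
  by (simp add: words_def card_PiE)

text \<open>Over a fixed choice of the other letters, an equation \<open>w u = w v\<close> on a letter \<open>w u\<close> that
  nothing else constrains selects one of its \<open>L\<close> values. In graph terms, \<open>u\<close> is a leaf.\<close>

lemma card_free_letter:
  assumes "u < N" "v < N" "u \<noteq> v" and F: "\<And>w c. F (w(u := c)) = F w"
  shows "card {w \<in> words L N. F w \<and> w u = w v} * L = card {w \<in> words L N. F w}"
proof -
  have "bij_betw (\<lambda>(w, c). w(u := c)) ({w \<in> words L N. F w \<and> w u = w v} \<times> {1..L}) {w \<in> words L N. F w}"
    by (rule bij_betw_byWitness[where f' = "\<lambda>w. (w(u := w v), w u)"])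
      (use assms in \<open>auto simp: words_def PiE_iff extensional_def fun_upd_idem_iff\<close>)
  then show ?thesis
    using bij_betw_same_card by (fastforce simp: card_cartesian_product)
qed

text \<open>The equations form a forest on the positions \<open>{..<N}\<close>, which is dismantled leaf by leaf. If
  \<open>p \<le> q\<close> and \<open>q > 0\<close>, then \<open>m + q - 1\<close> is the largest position involved and lies on one edge
  only. If \<open>q < p\<close>, then \<open>p - 1\<close> is a leaf: it is no lower end of an \<open>m\<close>-edge because \<open>p - 1 \<ge> q\<close>,
  and no upper end of any edge because \<open>p - 1 < n\<close>; this is where \<open>p \<le> n\<close> enters.\<close>

lemma card_two_matches:
  assumes "p \<le> n" "n < m" "n + p \<le> N" "m + q \<le> N"
  shows "card {w \<in> words L N. matches n p w \<and> matches m q w} * L ^ (p + q) = L ^ N"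
  using assms
proof (induction "p + q" arbitrary: p q)
  case 0
  then show ?case by (simp add: matches_def card_words)
next
  case (Suc r)
  show ?case
  proof (cases "p \<le> q")
    case True
    with Suc.hyps(2) obtain q' where q: "q = Suc q'" by (cases q) auto
    have IH: "card {w \<in> words L N. matches n p w \<and> matches m q' w} * L ^ (p + q') = L ^ N"
      using Suc.prems Suc.hyps(2) q by (intro Suc.hyps(1)) auto
    have "card {w \<in> words L N. (matches n p w \<and> matches m q' w) \<and> w (m + q') = w q'} * L
        = card {w \<in> words L N. matches n p w \<and> matches m q' w}"
      using Suc.prems True q by (intro card_free_letter) (auto simp: matches_def)
    then show ?thesis using IH by (simp add: q matches_Suc conj_assoc mult.assoc[symmetric])
  next
    case False
    then obtain p' where p: "p = Suc p'" by (cases p) auto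
    have IH: "card {w \<in> words L N. matches n p' w \<and> matches m q w} * L ^ (p' + q) = L ^ N"
      using Suc.prems Suc.hyps(2) p by (intro Suc.hyps(1)) auto
    have "card {w \<in> words L N. (matches n p' w \<and> matches m q w) \<and> w p' = w (n + p')} * L
        = card {w \<in> words L N. matches n p' w \<and> matches m q w}"
      using Suc.prems False p by (intro card_free_letter) (auto simp: matches_def)
    moreover have "{w \<in> words L N. matches n p w \<and> matches m q w} =
        {w \<in> words L N. (matches n p' w \<and> matches m q w) \<and> w p' = w (n + p')}"
      by (auto simp: p matches_Suc)
    ultimately show ?thesis using IH by (simp add: p mult.assoc[symmetric])
  qed
qed

section \<open>Codes of the points of the attractor\<close>

lemma ifs_comp_eq:
  "ifs_comp \<rho> a \<epsilon> n y = (\<Sum>i<n. \<rho> ^ i * a (\<epsilon> i)) + \<rho> ^ n * y"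
  by (induction n arbitrary: y) (simp_all add: ifs_map_def algebra_simps)

lemma code_space_shift: "\<epsilon> \<in> code_space L \<Longrightarrow> (\<lambda>i. \<epsilon> (n + i)) \<in> code_space L"
  by (simp add: code_space_def)

locale separated_ifs =
  fixes L :: nat and \<rho> :: real and a :: "nat \<Rightarrow> real" and K :: "real set"
  assumes L: "2 \<le> L" and rho_pos: "0 < \<rho>" and rho_less: "\<rho> < 1"
    and a_range: "\<And>j. j \<in> {1..L} \<Longrightarrow> 0 \<le> a j \<and> a j \<le> 1 - \<rho>"
    and attractor: "is_attractor L \<rho> a K"
    and separation: "strong_separation L \<rho> a K"
begin

lemma compact_K: "compact K" and K_ne: "K \<noteq> {}" and K_unit: "K \<subseteq> {0..1}"
  and K_eq: "K = (\<Union>j\<in>{1..L}. ifs_map \<rho> a j ` K)"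
  using attractor by (auto simp: is_attractor_def)

lemma ifs_map_in_K: "j \<in> {1..L} \<Longrightarrow> x \<in> K \<Longrightarrow> ifs_map \<rho> a j x \<in> K"
  using K_eq by blast

lemma ifs_map_inj: "ifs_map \<rho> a j x = ifs_map \<rho> a j y \<longleftrightarrow> x = y"
  using rho_pos by (simp add: ifs_map_def)

lemma rho_power_tendsto: "(\<lambda>n. \<rho> ^ n * c) \<longlonglongrightarrow> 0"
  using rho_pos rho_less by (auto intro!: tendsto_mult_left_zero LIMSEQ_power_zero)

text \<open>The closed form of \<^const>\<open>code_proj\<close> on code sequences; it turns shifts of the code into
  index shifts of a series.\<close>

definition addr :: "(nat \<Rightarrow> nat) \<Rightarrow> real" where
  "addr \<epsilon> = (\<Sum>i. \<rho> ^ i * a (\<epsilon> i))"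

lemma addr_summable:
  assumes "\<epsilon> \<in> code_space L"
  shows "summable (\<lambda>i. \<rho> ^ i * a (\<epsilon> i))"
proof (rule summable_comparison_test')
  show "summable (\<lambda>i. \<rho> ^ i * (1 - \<rho>))"
    using rho_pos rho_less by (intro summable_mult2 summable_geometric) auto
  show "norm (\<rho> ^ i * a (\<epsilon> i)) \<le> \<rho> ^ i * (1 - \<rho>)" for i
    using assms a_range[of "\<epsilon> i"] rho_pos by (auto simp: code_space_def abs_mult)
qed

lemma addr_split:
  assumes "\<epsilon> \<in> code_space L"
  shows "addr \<epsilon> = (\<Sum>i<n. \<rho> ^ i * a (\<epsilon> i)) + \<rho> ^ n * addr (\<lambda>i. \<epsilon> (n + i))"
proof -
  have "addr \<epsilon> = (\<Sum>i. \<rho> ^ (i + n) * a (\<epsilon> (i + n))) + (\<Sum>i<n. \<rho> ^ i * a (\<epsilon> i))"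
    unfolding addr_def by (rule suminf_split_initial_segment[OF addr_summable[OF assms]])
  also have "(\<Sum>i. \<rho> ^ (i + n) * a (\<epsilon> (i + n))) = (\<Sum>i. \<rho> ^ n * (\<rho> ^ i * a (\<epsilon> (n + i))))"
    by (simp add: power_add ac_simps)
  also have "\<dots> = \<rho> ^ n * addr (\<lambda>i. \<epsilon> (n + i))"
    unfolding addr_def by (intro suminf_mult addr_summable code_space_shift assms)
  finally show ?thesis by simp
qed

lemma addr_tendsto:
  assumes "\<epsilon> \<in> code_space L" and y: "\<And>n. y n \<in> {0..1}"
  shows "(\<lambda>n. (\<Sum>i<n. \<rho> ^ i * a (\<epsilon> i)) + \<rho> ^ n * y n) \<longlonglongrightarrow> addr \<epsilon>"
proof -
  have "(\<lambda>n. \<rho> ^ n * y n) \<longlonglongrightarrow> 0"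
  proof (rule tendsto_rabs_zero_cancel, rule tendsto_sandwich[where f = "\<lambda>_. 0"])
    show "\<forall>\<^sub>F n in sequentially. \<bar>\<rho> ^ n * y n\<bar> \<le> \<rho> ^ n * 1"
      using y rho_pos by (auto simp: abs_mult)
    show "(\<lambda>n. \<rho> ^ n * 1) \<longlonglongrightarrow> 0" by (rule rho_power_tendsto)
  qed auto
  from tendsto_add[OF summable_LIMSEQ[OF addr_summable[OF assms(1)]] this] show ?thesis
    by (simp add: addr_def)
qed

text \<open>The attractor is mapped into itself by every finite composition, so \<open>addr \<epsilon>\<close> is a limit of
  points of the closed set \<open>K\<close>.\<close>

lemma addr_in_K:
  assumes \<epsilon>: "\<epsilon> \<in> code_space L"
  shows "addr \<epsilon> \<in> K"
proof -
  obtain y where y: "y \<in> K" using K_ne by blast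
  have mem: "ifs_comp \<rho> a \<epsilon> n z \<in> K" if "z \<in> K" for n z
    using that
  proof (induction n arbitrary: z)
    case (Suc n)
    then show ?case using \<epsilon> by (auto simp: code_space_def intro!: Suc.IH ifs_map_in_K)
  qed simp
  have "(\<lambda>n. ifs_comp \<rho> a \<epsilon> n y) \<longlonglongrightarrow> addr \<epsilon>"
    unfolding ifs_comp_eq using y K_unit by (intro addr_tendsto \<epsilon>) auto
  then show ?thesis
    by (rule closed_sequentially[OF compact_imp_closed[OF compact_K], rotated]) (rule mem[OF y])
qed

lemma addr_unit: "\<epsilon> \<in> code_space L \<Longrightarrow> addr \<epsilon> \<in> {0..1}"
  using addr_in_K K_unit by blast

lemma code_proj_eq:
  assumes \<epsilon>: "\<epsilon> \<in> code_space L"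
  shows "code_proj \<rho> a \<epsilon> = addr \<epsilon>"
  unfolding code_proj_def
proof (rule the_equality)
  have "addr \<epsilon> = ifs_comp \<rho> a \<epsilon> n (addr (\<lambda>i. \<epsilon> (n + i)))" for n
    unfolding ifs_comp_eq by (rule addr_split[OF \<epsilon>])
  then show "addr \<epsilon> \<in> (\<Inter>n\<in>{1..}. ifs_comp \<rho> a \<epsilon> n ` {0..1})"
    using addr_unit[OF code_space_shift[OF \<epsilon>]] by blast
next
  fix x assume x: "x \<in> (\<Inter>n\<in>{1..}. ifs_comp \<rho> a \<epsilon> n ` {0..1})"
  have "\<exists>z\<in>{0..1}. x = (\<Sum>i<n. \<rho> ^ i * a (\<epsilon> i)) + \<rho> ^ n * z" if "1 \<le> n" for n
    using x that unfolding ifs_comp_eq by blast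
  then have "\<exists>z\<in>{0..1}. x = (\<Sum>i<Suc n. \<rho> ^ i * a (\<epsilon> i)) + \<rho> ^ Suc n * z" for n
    by (metis le_add1 plus_1_eq_Suc)
  then obtain y where y: "\<And>n. y n \<in> {0..1}"
    "\<And>n. x = (\<Sum>i<Suc n. \<rho> ^ i * a (\<epsilon> i)) + \<rho> ^ Suc n * y n" by metis
  \<comment> \<open>\<open>y n\<close> is the witness at depth \<open>Suc n\<close>, hence the shifted index\<close>
  have "(\<lambda>n. (\<Sum>i<Suc n. \<rho> ^ i * a (\<epsilon> i)) + \<rho> ^ Suc n * y (Suc n - 1)) \<longlonglongrightarrow> addr \<epsilon>"
    using LIMSEQ_Suc[OF addr_tendsto[OF \<epsilon>, of "\<lambda>n. y (n - 1)"]] y(1) by simp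
  then have "(\<lambda>n::nat. x) \<longlonglongrightarrow> addr \<epsilon>" using y(2) by simp
  then show "x = addr \<epsilon>" using LIMSEQ_unique tendsto_const by blast
qed

text \<open>Choosing a preimage under some map of the system again and again reads off a code.\<close>

lemma K_addr:
  assumes "x \<in> K"
  shows "\<exists>\<epsilon>\<in>code_space L. x = addr \<epsilon>"
proof -
  have "\<forall>y\<in>K. \<exists>j z. j \<in> {1..L} \<and> z \<in> K \<and> y = ifs_map \<rho> a j z"
    using K_eq by blast
  then obtain d s where ds: "\<And>y. y \<in> K \<Longrightarrow> d y \<in> {1..L} \<and> s y \<in> K \<and> y = ifs_map \<rho> a (d y) (s y)"
    by metis
  define \<epsilon> where "\<epsilon> i = d ((s ^^ i) x)" for i
  have sK: "(s ^^ i) x \<in> K" for i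
    using assms ds by (induction i) auto
  have \<epsilon>: "\<epsilon> \<in> code_space L"
    using ds sK by (auto simp: code_space_def \<epsilon>_def)
  have "x = (\<Sum>i<n. \<rho> ^ i * a (\<epsilon> i)) + \<rho> ^ n * (s ^^ n) x" for n
  proof (induction n)
    case (Suc n)
    have "(s ^^ n) x = \<rho> * (s ^^ Suc n) x + a (\<epsilon> n)"
      using ds[OF sK[of n]] by (simp add: \<epsilon>_def ifs_map_def)
    then have "\<rho> ^ n * (s ^^ n) x = \<rho> ^ n * a (\<epsilon> n) + \<rho> ^ Suc n * (s ^^ Suc n) x"
      by (metis add.commute distrib_left mult.assoc power_Suc2)
    with Suc show ?case by (simp only: sum.lessThan_Suc add.assoc)
  qed simp
  then have "(\<lambda>n::nat. x) \<longlonglongrightarrow> addr \<epsilon>"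
    using addr_tendsto[OF \<epsilon>, of "\<lambda>n. (s ^^ n) x"] sK K_unit by fastforce
  then show ?thesis using LIMSEQ_unique tendsto_const \<epsilon> by blast
qed

text \<open>The differences between points of distinct first-level pieces form a compact set that misses
  \<open>0\<close>.\<close>

lemma gap_exists:
  "\<exists>\<delta>>0. \<forall>i\<in>{1..L}. \<forall>j\<in>{1..L}. \<forall>x\<in>K. \<forall>y\<in>K.
     i \<noteq> j \<longrightarrow> \<delta> \<le> \<bar>ifs_map \<rho> a i x - ifs_map \<rho> a j y\<bar>"
proof -
  define D where "D = (\<Union>(i, j)\<in>{(i, j) \<in> {1..L} \<times> {1..L}. i \<noteq> j}.
     {x - y |x y. x \<in> ifs_map \<rho> a i ` K \<and> y \<in> ifs_map \<rho> a j ` K})"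
  have "compact (ifs_map \<rho> a i ` K)" for i
    unfolding ifs_map_def by (intro compact_continuous_image continuous_intros compact_K)
  then have "compact D"
    unfolding D_def
    by (intro compact_UN finite_subset[OF _ finite_cartesian_product[of "{1..L}" "{1..L}"]])
      (auto intro!: compact_differences)
  moreover have "0 \<notin> D"
    using separation unfolding D_def strong_separation_def disjoint_family_on_def by fastforce
  ultimately obtain \<delta> where "\<delta> > 0" "ball 0 \<delta> \<subseteq> - D"
    using compact_imp_closed open_contains_ball by (metis ComplI open_Compl)
  then have "\<delta> \<le> \<bar>d\<bar>" if "d \<in> D" for d
    using that by (force simp: subset_iff dist_real_def)
  then show ?thesis using \<open>\<delta> > 0\<close> unfolding D_def by (intro exI[of _ \<delta>]) blast
qed

definition gap :: real where
  "gap = (SOME \<delta>. 0 < \<delta> \<and> (\<forall>i\<in>{1..L}. \<forall>j\<in>{1..L}. \<forall>x\<in>K. \<forall>y\<in>K.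
     i \<noteq> j \<longrightarrow> \<delta> \<le> \<bar>ifs_map \<rho> a i x - ifs_map \<rho> a j y\<bar>))"

lemma gap_pos: "0 < gap"
  and gap: "\<lbrakk>i \<in> {1..L}; j \<in> {1..L}; x \<in> K; y \<in> K; i \<noteq> j\<rbrakk>
     \<Longrightarrow> gap \<le> \<bar>ifs_map \<rho> a i x - ifs_map \<rho> a j y\<bar>"
  using someI_ex[OF gap_exists, folded gap_def] by auto

lemma addr_dist_le:
  assumes "\<epsilon> \<in> code_space L" "\<epsilon>' \<in> code_space L" "\<And>i. i < k \<Longrightarrow> \<epsilon> i = \<epsilon>' i"
  shows "\<bar>addr \<epsilon> - addr \<epsilon>'\<bar> \<le> \<rho> ^ k"
proof -
  have "addr \<epsilon> - addr \<epsilon>' = \<rho> ^ k * (addr (\<lambda>i. \<epsilon> (k + i)) - addr (\<lambda>i. \<epsilon>' (k + i)))"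
    using assms addr_split[of \<epsilon> k] addr_split[of \<epsilon>' k] by (simp add: right_diff_distrib)
  moreover have "\<bar>addr (\<lambda>i. \<epsilon> (k + i)) - addr (\<lambda>i. \<epsilon>' (k + i))\<bar> \<le> 1"
    using addr_unit[OF code_space_shift[OF assms(1), of k]]
      addr_unit[OF code_space_shift[OF assms(2), of k]] by auto
  ultimately show ?thesis
    using rho_pos by (simp add: abs_mult mult_left_le)
qed

text \<open>At the first letter where the codes differ the shifted points lie in distinct first-level
  pieces, hence at least \<open>gap\<close> apart, and that position is at most \<open>k - 1\<close>.\<close>

lemma addr_dist_ge:
  assumes "\<epsilon> \<in> code_space L" "\<epsilon>' \<in> code_space L" "i < k" "\<epsilon> i \<noteq> \<epsilon>' i"
  shows "gap * \<rho> ^ (k - 1) \<le> \<bar>addr \<epsilon> - addr \<epsilon>'\<bar>"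
proof -
  define n where "n = (LEAST i. \<epsilon> i \<noteq> \<epsilon>' i)"
  have n: "\<epsilon> n \<noteq> \<epsilon>' n" and "n \<le> i"
    unfolding n_def using LeastI[of "\<lambda>i. \<epsilon> i \<noteq> \<epsilon>' i", OF assms(4)]
      Least_le[of "\<lambda>i. \<epsilon> i \<noteq> \<epsilon>' i", OF assms(4)] by blast+
  have same: "\<epsilon> i = \<epsilon>' i" if "i < n" for i
    using not_less_Least[of i "\<lambda>i. \<epsilon> i \<noteq> \<epsilon>' i"] that unfolding n_def by blast
  have tail: "addr (\<lambda>i. \<eta> (n + i)) = ifs_map \<rho> a (\<eta> n) (addr (\<lambda>i. \<eta> (Suc n + i)))"
    if "\<eta> \<in> code_space L" for \<eta>
    using addr_split[OF code_space_shift[OF that, of n], of 1] by (simp add: ifs_map_def)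
  have "addr \<epsilon> - addr \<epsilon>' = \<rho> ^ n * (addr (\<lambda>i. \<epsilon> (n + i)) - addr (\<lambda>i. \<epsilon>' (n + i)))"
    using assms same addr_split[of \<epsilon> n] addr_split[of \<epsilon>' n] by (simp add: right_diff_distrib)
  moreover have "gap \<le> \<bar>addr (\<lambda>i. \<epsilon> (n + i)) - addr (\<lambda>i. \<epsilon>' (n + i))\<bar>"
    unfolding tail[OF assms(1)] tail[OF assms(2)] using assms(1,2) n
    by (intro gap addr_in_K code_space_shift) (auto simp: code_space_def)
  ultimately have "gap * \<rho> ^ n \<le> \<bar>addr \<epsilon> - addr \<epsilon>'\<bar>"
    using rho_pos by (simp add: abs_mult mult.commute)
  moreover have "\<rho> ^ (k - 1) \<le> \<rho> ^ n"
    using \<open>n \<le> i\<close> \<open>i < k\<close> rho_pos rho_less by (intro power_decreasing) auto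
  ultimately show ?thesis
    using gap_pos mult_left_mono[of "\<rho> ^ (k - 1)" "\<rho> ^ n" gap] by linarith
qed

lemma addr_inj:
  assumes "\<epsilon> \<in> code_space L" "\<epsilon>' \<in> code_space L" "addr \<epsilon> = addr \<epsilon>'"
  shows "\<epsilon> = \<epsilon>'"
proof
  fix i
  show "\<epsilon> i = \<epsilon>' i"
    using addr_dist_ge[OF assms(1,2), of i "Suc i"] assms(3) mult_pos_pos[OF gap_pos, of "\<rho> ^ i"]
      rho_pos by fastforce
qed

lemma coding_addr: "\<epsilon> \<in> code_space L \<Longrightarrow> coding L \<rho> a (addr \<epsilon>) = \<epsilon>"
  unfolding coding_def by (rule the_equality) (auto simp: code_proj_eq addr_inj)

lemma coding_code_space: "x \<in> K \<Longrightarrow> coding L \<rho> a x \<in> code_space L"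
  using K_addr coding_addr by fastforce

lemma addr_coding: "x \<in> K \<Longrightarrow> addr (coding L \<rho> a x) = x"
  using K_addr coding_addr by fastforce

lemma shift_map_funpow:
  assumes "\<epsilon> \<in> code_space L"
  shows "(shift_map L \<rho> a ^^ n) (addr \<epsilon>) = addr (\<lambda>i. \<epsilon> (n + i))"
proof (induction n)
  case (Suc n)
  have "left_shift (\<lambda>i. \<epsilon> (n + i)) = (\<lambda>i. \<epsilon> (Suc n + i))"
    by (simp add: left_shift_def)
  then show ?case
    using Suc code_space_shift[OF assms, of n] code_space_shift[OF assms, of "Suc n"]
    by (simp add: shift_map_def coding_addr code_proj_eq)
qed simp

end

section \<open>Independence of the letters under the self-similar measure\<close>

locale self_similar_system = separated_ifs +
  fixes \<mu> :: "real measure"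
  assumes self_similar: "is_self_similar_measure L \<rho> a K \<mu>"
begin

sublocale prob_space \<mu>
  using self_similar by (simp add: is_self_similar_measure_def)

lemma sets_mu [measurable_cong, simp]: "sets \<mu> = sets borel"
  using self_similar by (simp add: is_self_similar_measure_def)

lemma space_mu [simp]: "space \<mu> = UNIV"
  using sets_eq_imp_space_eq[OF sets_mu] by simp

lemma K_borel [measurable]: "K \<in> sets borel"
  by (rule borel_compact[OF compact_K])

lemma prob_K: "prob K = 1"
  using prob_compl[of "- K"] self_similar by (simp add: is_self_similar_measure_def Compl_eq_Diff_UNIV[symmetric])

lemma prob_outside_K:
  assumes "A \<inter> K = {}"
  shows "prob A = 0"
proof -
  have "prob A \<le> prob (- K)"
    using assms by (intro finite_measure_mono) auto
  then show ?thesis using self_similar by (simp add: is_self_similar_measure_def measure_le_0_iff)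
qed

text \<open>Of the \<open>L\<close> preimages in the self-similarity relation only the one under \<open>ifs_map \<rho> a j\<close>
  itself carries mass, because the other pieces of \<open>K\<close> are disjoint from the image.\<close>

lemma prob_ifs_map_image:
  assumes j: "j \<in> {1..L}" and B: "compact B" "B \<subseteq> K"
  shows "compact (ifs_map \<rho> a j ` B)" and "prob (ifs_map \<rho> a j ` B) = prob B / L"
proof -
  show c: "compact (ifs_map \<rho> a j ` B)"
    unfolding ifs_map_def by (intro compact_continuous_image continuous_intros B)
  have "prob (ifs_map \<rho> a i -` (ifs_map \<rho> a j ` B) \<inter> {0..1}) = (if i = j then prob B else 0)"
    if i: "i \<in> {1..L}" for i
  proof (cases "i = j")
    case True
    have "ifs_map \<rho> a j -` (ifs_map \<rho> a j ` B) \<inter> {0..1} = B"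
      using B(2) K_unit by (auto simp: ifs_map_inj)
    with True show ?thesis by simp
  next
    case False
    then have "ifs_map \<rho> a i ` K \<inter> ifs_map \<rho> a j ` K = {}"
      using separation i j unfolding strong_separation_def disjoint_family_on_def by blast
    with False B(2) show ?thesis by (auto intro!: prob_outside_K)
  qed
  then have "(\<Sum>i=1..L. prob (ifs_map \<rho> a i -` (ifs_map \<rho> a j ` B) \<inter> {0..1})) = prob B"
    using j by (simp add: sum.delta)
  moreover have "ifs_map \<rho> a j ` B \<in> sets borel"
    by (rule borel_compact[OF c])
  ultimately show "prob (ifs_map \<rho> a j ` B) = prob B / L"
    using self_similar unfolding is_self_similar_measure_def by simp
qed

text \<open>The argument \<open>w\<close> may be the code of a point as well as a word of length \<open>N\<close>.\<close>

definition cyl :: "(nat \<Rightarrow> nat) \<Rightarrow> nat \<Rightarrow> real set" where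
  "cyl w N = {x \<in> K. \<forall>i<N. coding L \<rho> a x i = w i}"

lemma addr_in_cyl: "\<epsilon> \<in> code_space L \<Longrightarrow> addr \<epsilon> \<in> cyl w N \<longleftrightarrow> (\<forall>i<N. \<epsilon> i = w i)"
  by (simp add: cyl_def addr_in_K coding_addr)

lemma addr_cases:
  assumes "x \<in> K"
  obtains \<epsilon> where "\<epsilon> \<in> code_space L" "x = addr \<epsilon>"
  using K_addr[OF assms] by blast

lemma addr_Suc:
  "\<epsilon> \<in> code_space L \<Longrightarrow> addr \<epsilon> = ifs_map \<rho> a (\<epsilon> 0) (addr (\<lambda>i. \<epsilon> (Suc i)))"
  using addr_split[of \<epsilon> 1] by (simp add: ifs_map_def)

lemma cyl_Suc:
  assumes "w 0 \<in> {1..L}"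
  shows "cyl w (Suc N) = ifs_map \<rho> a (w 0) ` cyl (\<lambda>i. w (Suc i)) N"
proof (intro equalityI subsetI)
  fix x assume x: "x \<in> cyl w (Suc N)"
  then have "x \<in> K" by (simp add: cyl_def)
  then obtain \<epsilon> where \<epsilon>: "\<epsilon> \<in> code_space L" "x = addr \<epsilon>" by (rule addr_cases)
  with x have "\<forall>i<Suc N. \<epsilon> i = w i" by (simp add: addr_in_cyl)
  moreover have sh: "(\<lambda>i. \<epsilon> (Suc i)) \<in> code_space L"
    using code_space_shift[OF \<epsilon>(1), of 1] by simp
  ultimately have "addr (\<lambda>i. \<epsilon> (Suc i)) \<in> cyl (\<lambda>i. w (Suc i)) N" "\<epsilon> 0 = w 0"
    by (auto simp: addr_in_cyl[OF sh])
  with addr_Suc[OF \<epsilon>(1)] \<epsilon>(2) show "x \<in> ifs_map \<rho> a (w 0) ` cyl (\<lambda>i. w (Suc i)) N"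
    by simp
next
  fix x assume "x \<in> ifs_map \<rho> a (w 0) ` cyl (\<lambda>i. w (Suc i)) N"
  then obtain y where y: "x = ifs_map \<rho> a (w 0) y" "y \<in> cyl (\<lambda>i. w (Suc i)) N" by blast
  then have "y \<in> K" by (simp add: cyl_def)
  then obtain \<epsilon> where \<epsilon>: "\<epsilon> \<in> code_space L" "y = addr \<epsilon>" by (rule addr_cases)
  define \<eta> where "\<eta> = case_nat (w 0) \<epsilon>"
  have \<eta>: "\<eta> \<in> code_space L"
    using \<epsilon>(1) assms by (auto simp: code_space_def \<eta>_def split: nat.split)
  have "addr \<eta> = x"
    using addr_Suc[OF \<eta>] y(1) \<epsilon>(2) by (simp add: \<eta>_def)
  moreover have "\<forall>i<Suc N. \<eta> i = w i"
    using y(2) \<epsilon> by (auto simp: addr_in_cyl \<eta>_def less_Suc_eq_0_disj)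
  ultimately show "x \<in> cyl w (Suc N)"
    using addr_in_cyl[OF \<eta>] by metis
qed

lemma cyl_compact_prob:
  assumes "\<And>i. i < N \<Longrightarrow> w i \<in> {1..L}"
  shows "compact (cyl w N) \<and> prob (cyl w N) = 1 / L ^ N"
  using assms
proof (induction N arbitrary: w)
  case 0
  then show ?case by (simp add: cyl_def compact_K prob_K)
next
  case (Suc N)
  have IH: "compact (cyl (\<lambda>i. w (Suc i)) N) \<and> prob (cyl (\<lambda>i. w (Suc i)) N) = 1 / L ^ N"
    using Suc.prems by (intro Suc.IH) auto
  have w0: "w 0 \<in> {1..L}" and sub: "cyl (\<lambda>i. w (Suc i)) N \<subseteq> K"
    using Suc.prems by (auto simp: cyl_def)
  show ?case
    using IH prob_ifs_map_image[OF w0 _ sub] unfolding cyl_Suc[of w, OF w0] by (simp add: mult.commute)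
qed

lemma words_range: "w \<in> words L N \<Longrightarrow> i < N \<Longrightarrow> w i \<in> {1..L}"
  by (auto simp: words_def PiE_iff)

lemma cyl_borel: "w \<in> words L N \<Longrightarrow> cyl w N \<in> sets borel"
  using cyl_compact_prob[of N w] words_range borel_compact by blast

lemma prob_cyl: "w \<in> words L N \<Longrightarrow> prob (cyl w N) = 1 / L ^ N"
  using cyl_compact_prob[of N w] words_range by blast

lemma restrict_coding_words: "x \<in> K \<Longrightarrow> restrict (coding L \<rho> a x) {..<N} \<in> words L N"
  using coding_code_space by (auto simp: words_def code_space_def)

lemma cyl_restrict_coding: "x \<in> K \<Longrightarrow> x \<in> cyl (restrict (coding L \<rho> a x) {..<N}) N"
  by (simp add: cyl_def)

lemma K_cyl_cover: "K = (\<Union>w\<in>words L N. cyl w N)"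
proof
  show "K \<subseteq> (\<Union>w\<in>words L N. cyl w N)"
    using restrict_coding_words cyl_restrict_coding by blast
qed (auto simp: cyl_def)

lemma disjoint_cyl: "disjoint_family_on (\<lambda>w. cyl w N) (words L N)"
proof -
  have "w = w'" if "w \<in> words L N" "w' \<in> words L N" "x \<in> cyl w N" "x \<in> cyl w' N" for w w' x
  proof
    fix i
    show "w i = w' i"
    proof (cases "i < N")
      case True
      with that(3,4) have "coding L \<rho> a x i = w i" "coding L \<rho> a x i = w' i"
        by (simp_all add: cyl_def)
      then show ?thesis by simp
    next
      case False
      with that(1,2) have "w i = undefined" "w' i = undefined"
        unfolding words_def by (auto intro: PiE_arb)
      then show ?thesis by simp
    qed
  qed
  then show ?thesis unfolding disjoint_family_on_def by blast
qed

definition coded :: "((nat \<Rightarrow> nat) \<Rightarrow> bool) \<Rightarrow> real set" where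
  "coded Q = {x \<in> K. Q (coding L \<rho> a x)}"

text \<open>This makes the letters independent and uniform: an event that depends on the first \<open>N\<close>
  letters is a disjoint union of cylinders of depth \<open>N\<close>, so its probability is a proportion of
  words.\<close>

lemma coded_prob:
  assumes Q: "\<And>\<epsilon> \<epsilon>'. (\<And>i. i < N \<Longrightarrow> \<epsilon> i = \<epsilon>' i) \<Longrightarrow> Q \<epsilon> = Q \<epsilon>'"
  shows "coded Q \<in> sets borel" and "prob (coded Q) = card {w \<in> words L N. Q w} / L ^ N"
proof -
  have eq: "coded Q = (\<Union>w\<in>{w \<in> words L N. Q w}. cyl w N)"
  proof (intro equalityI subsetI)
    fix x assume "x \<in> coded Q"
    then have "x \<in> K" "Q (restrict (coding L \<rho> a x) {..<N})"
      using Q[of "coding L \<rho> a x" "restrict (coding L \<rho> a x) {..<N}"] by (auto simp: coded_def)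
    then show "x \<in> (\<Union>w\<in>{w \<in> words L N. Q w}. cyl w N)"
      using restrict_coding_words cyl_restrict_coding by blast
  next
    fix x assume "x \<in> (\<Union>w\<in>{w \<in> words L N. Q w}. cyl w N)"
    then obtain w where "Q w" "x \<in> cyl w N" by blast
    then show "x \<in> coded Q"
      using Q[of "coding L \<rho> a x" w] by (auto simp: coded_def cyl_def)
  qed
  have fin: "finite {w \<in> words L N. Q w}" using finite_words by simp
  show "coded Q \<in> sets borel"
    unfolding eq using fin cyl_borel by (intro sets.finite_UN) auto
  have "prob (coded Q) = (\<Sum>w\<in>{w \<in> words L N. Q w}. prob (cyl w N))"
    unfolding eq using fin cyl_borel disjoint_cyl[of N]
    by (intro finite_measure_finite_Union) (auto simp: disjoint_family_on_def)
  then show "prob (coded Q) = card {w \<in> words L N. Q w} / L ^ N"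
    by (simp add: prob_cyl)
qed

lemma prob_two_matches:
  assumes "p \<le> n" "n < m"
  shows "prob (coded (\<lambda>\<epsilon>. matches n p \<epsilon> \<and> matches m q \<epsilon>)) = 1 / L ^ (p + q)"
proof -
  define N where "N = n + p + m + q"
  have "prob (coded (\<lambda>\<epsilon>. matches n p \<epsilon> \<and> matches m q \<epsilon>)) =
      card {w \<in> words L N. matches n p w \<and> matches m q w} / L ^ N"
    unfolding N_def by (intro coded_prob) (simp add: matches_def)
  moreover have "real (card {w \<in> words L N. matches n p w \<and> matches m q w}) * L ^ (p + q) = L ^ N"
    using arg_cong[where f = real, OF card_two_matches[OF assms, of N q L]] by (simp add: N_def)
  ultimately show ?thesis
    using L frac_eq_eq[of "real L ^ N" "real L ^ (p + q)" "real (card {w \<in> words L N. matches n p w \<and> matches m q w})" 1]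
    by simp
qed

lemma matches_borel [measurable]: "coded (matches n k) \<in> sets borel"
  by (rule coded_prob(1)[of "n + k"]) (simp add: matches_def)

lemma prob_matches: "0 < n \<Longrightarrow> prob (coded (matches n k)) = 1 / L ^ k"
  using prob_two_matches[of 0 0 n k] by (simp add: matches_def[of 0] coded_def)

lemma prob_matches_Int:
  assumes "p \<le> n" "0 < n" "n < m"
  shows "prob (coded (matches n p) \<inter> coded (matches m q)) =
    prob (coded (matches n p)) * prob (coded (matches m q))"
proof -
  have "coded (matches n p) \<inter> coded (matches m q) = coded (\<lambda>\<epsilon>. matches n p \<epsilon> \<and> matches m q \<epsilon>)"
    by (auto simp: coded_def)
  with assms show ?thesis by (simp add: prob_two_matches prob_matches power_add)
qed

end

section \<open>Probability of close returns\<close>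

context separated_ifs
begin

definition similarity_dim :: real where
  "similarity_dim = ln L / (- ln \<rho>)"

lemma similarity_dim_pos: "0 < similarity_dim"
  unfolding similarity_dim_def using L rho_pos rho_less by (intro divide_pos_pos) auto

lemma rho_power_powr: "(\<rho> ^ k) powr similarity_dim = 1 / L ^ k"
proof -
  have "ln \<rho> < 0" using rho_pos rho_less by simp
  then have "\<rho> powr similarity_dim = exp (- ln L)"
    using rho_pos unfolding powr_def similarity_dim_def by simp
  also have "\<dots> = 1 / L" using L by (simp add: exp_minus field_simps)
  finally have base: "\<rho> powr similarity_dim = 1 / L" .
  have "(\<rho> ^ k) powr similarity_dim = \<rho> powr (similarity_dim * k)"
    unfolding powr_realpow[OF rho_pos, symmetric] powr_powr by (simp only: mult.commute)
  also have "\<dots> = (1 / L) ^ k"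
    using L by (simp only: powr_powr[symmetric] base) (simp add: powr_realpow)
  finally show ?thesis by (simp add: power_one_over)
qed

text \<open>The number of common letters that forces two points to be closer than \<open>r\<close>.\<close>

definition level :: "real \<Rightarrow> nat" where
  "level r = (LEAST k. \<rho> ^ k < r)"

lemma level_less: "0 < r \<Longrightarrow> \<rho> ^ level r < r"
  unfolding level_def using real_arch_pow_inv[of r \<rho>] rho_less by (auto intro: LeastI_ex)

lemma level_ge: "0 < level r \<Longrightarrow> r \<le> \<rho> ^ (level r - 1)"
  using not_less_Least[of "level r - 1" "\<lambda>k. \<rho> ^ k < r"] unfolding level_def[symmetric] by fastforce

lemma level_powr_le: "0 < r \<Longrightarrow> 1 / L ^ level r \<le> r powr similarity_dim"
  using level_less[of r] similarity_dim_pos rho_pos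
  unfolding rho_power_powr[symmetric] by (intro powr_mono2) auto

text \<open>Minimality of the level bounds \<open>r\<close> by the preceding power of \<open>\<rho>\<close>, at the cost of one factor
  \<open>L\<close>. At level \<open>0\<close> there is no such bound, as \<open>r\<close> may then be arbitrarily large.\<close>

lemma level_powr_ge:
  assumes "0 < r" "0 < level r"
  shows "r powr similarity_dim \<le> L / L ^ level r"
proof -
  obtain k where k: "level r = Suc k" using assms(2) by (cases "level r") auto
  have "r powr similarity_dim \<le> (\<rho> ^ k) powr similarity_dim"
    using level_ge[OF assms(2)] assms(1) similarity_dim_pos k by (intro powr_mono2) auto
  then show ?thesis using L by (simp add: rho_power_powr k)
qed

lemma close_points_share_prefix:
  assumes "x \<in> K" "y \<in> K" "\<bar>x - y\<bar> < r" "i < level (r / gap)"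
  shows "coding L \<rho> a x i = coding L \<rho> a y i"
proof (rule ccontr)
  assume "coding L \<rho> a x i \<noteq> coding L \<rho> a y i"
  then have "gap * \<rho> ^ (level (r / gap) - 1) \<le> \<bar>x - y\<bar>"
    using addr_dist_ge[OF coding_code_space coding_code_space assms(4)] assms(1,2)
    by (simp add: addr_coding)
  moreover have "r \<le> gap * \<rho> ^ (level (r / gap) - 1)"
    using level_ge[of "r / gap"] assms(4) gap_pos by (simp add: field_simps)
  ultimately show False using assms(3) by simp
qed

lemma shift_map_in_K: "x \<in> K \<Longrightarrow> (shift_map L \<rho> a ^^ n) x \<in> K"
  using shift_map_funpow[OF coding_code_space] addr_in_K code_space_shift coding_code_space
  by (metis addr_coding)

lemma coding_shift_map:
  "x \<in> K \<Longrightarrow> coding L \<rho> a ((shift_map L \<rho> a ^^ n) x) = (\<lambda>i. coding L \<rho> a x (n + i))"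
  using shift_map_funpow[OF coding_code_space, of x n] coding_addr[OF code_space_shift[OF coding_code_space, of x n]]
  by (simp add: addr_coding)

definition near_return :: "nat \<Rightarrow> real \<Rightarrow> real set" where
  "near_return n r = {x \<in> K. \<bar>(shift_map L \<rho> a ^^ n) x - x\<bar> < r}"

end

context self_similar_system
begin

lemma coded_matches_eq:
  "x \<in> coded (matches n k) \<longleftrightarrow>
    x \<in> K \<and> (\<forall>i<k. coding L \<rho> a ((shift_map L \<rho> a ^^ n) x) i = coding L \<rho> a x i)"
  by (auto simp: coded_def matches_def coding_shift_map)

lemma coded_matches_subset_near_return:
  assumes "0 < r"
  shows "coded (matches n (level r)) \<subseteq> near_return n r"
proof
  fix x assume "x \<in> coded (matches n (level r))"
  then have x: "x \<in> K"
    and same: "\<And>i. i < level r \<Longrightarrow> coding L \<rho> a ((shift_map L \<rho> a ^^ n) x) i = coding L \<rho> a x i"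
    by (auto simp: coded_matches_eq)
  have "\<bar>(shift_map L \<rho> a ^^ n) x - x\<bar> \<le> \<rho> ^ level r"
    using addr_dist_le[OF coding_code_space[OF shift_map_in_K[OF x]] coding_code_space[OF x] same]
    by (simp add: addr_coding x shift_map_in_K)
  then show "x \<in> near_return n r"
    using level_less[OF assms] x by (simp add: near_return_def)
qed

lemma near_return_subset_coded_matches:
  "near_return n r \<subseteq> coded (matches n (level (r / gap)))"
  using close_points_share_prefix shift_map_in_K by (auto simp: near_return_def coded_matches_eq)

lemma prob_near_return_le:
  assumes "0 < r" "0 < n"
  shows "prob (near_return n r) \<le> (r / gap) powr similarity_dim"
proof -
  have "prob (near_return n r) \<le> prob (coded (matches n (level (r / gap))))"
    using near_return_subset_coded_matches by (intro finite_measure_mono) auto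
  also have "\<dots> \<le> (r / gap) powr similarity_dim"
    using assms gap_pos by (simp add: prob_matches level_powr_le del: of_nat_power)
  finally show ?thesis .
qed

text \<open>On each cylinder of depth \<open>n\<close> the \<open>n\<close>-th iterate of the shift map is affine.\<close>

lemma near_return_borel [measurable]: "near_return n r \<in> sets borel"
proof -
  define f where "f w x = (x - (\<Sum>i<n. \<rho> ^ i * a (w i))) / \<rho> ^ n - x" for w :: "nat \<Rightarrow> nat" and x
  have f: "(shift_map L \<rho> a ^^ n) x - x = f w x" if "x \<in> cyl w n" for w x
  proof -
    have x: "x \<in> K" using that by (simp add: cyl_def)
    have "x = (\<Sum>i<n. \<rho> ^ i * a (w i)) + \<rho> ^ n * (shift_map L \<rho> a ^^ n) x"
      using addr_split[OF coding_code_space[OF x], of n] shift_map_funpow[OF coding_code_space[OF x], of n] that x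
      by (simp add: addr_coding cyl_def)
    then have "(shift_map L \<rho> a ^^ n) x = (x - (\<Sum>i<n. \<rho> ^ i * a (w i))) / \<rho> ^ n"
      using rho_pos by (simp add: field_simps)
    then show ?thesis by (simp add: f_def)
  qed
  have "near_return n r = (\<Union>w\<in>words L n. cyl w n \<inter> {x. \<bar>f w x\<bar> < r})"
    unfolding near_return_def by (subst K_cyl_cover[of n]) (auto simp: f)
  moreover have "{x. \<bar>f w x\<bar> < r} \<in> sets borel" for w
    unfolding f_def by measurable
  ultimately show ?thesis
    using finite_words cyl_borel by (auto intro!: sets.finite_UN)
qed

lemma recurrence_set_eq:
  "recurrence_set L \<rho> a K \<phi> = {x \<in> K. infinite {n. x \<in> near_return (Suc n) (\<phi> (Suc n))}}"
proof -
  have "{n. 1 \<le> n \<and> P n} = Suc ` {n. P (Suc n)}" for P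
    by (auto simp: image_iff) (metis Suc_le_D)
  then show ?thesis
    unfolding recurrence_set_def near_return_def by (auto simp: finite_image_iff)
qed

lemma recurrence_set_borel: "recurrence_set L \<rho> a K \<phi> \<in> sets borel"
proof -
  have "recurrence_set L \<rho> a K \<phi> = K \<inter> (\<Inter>m. \<Union>n\<in>{m..}. near_return (Suc n) (\<phi> (Suc n)))"
    unfolding recurrence_set_eq infinite_nat_iff_unbounded_le by auto
  then show ?thesis by simp
qed

lemma recurrence_null:
  assumes pos: "\<And>n. 1 \<le> n \<Longrightarrow> 0 < \<phi> n"
    and sum: "summable (\<lambda>n. \<phi> (Suc n) powr similarity_dim)"
  shows "prob (recurrence_set L \<rho> a K \<phi>) = 0"
proof -
  have "summable (\<lambda>n. prob (near_return (Suc n) (\<phi> (Suc n))))"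
  proof (rule summable_comparison_test')
    show "summable (\<lambda>n. \<phi> (Suc n) powr similarity_dim / gap powr similarity_dim)"
      by (intro summable_divide sum)
    show "norm (prob (near_return (Suc n) (\<phi> (Suc n)))) \<le> \<phi> (Suc n) powr similarity_dim / gap powr similarity_dim" for n
      using prob_near_return_le[of "\<phi> (Suc n)" "Suc n"] pos[of "Suc n"] gap_pos by (simp add: powr_divide)
  qed
  then have "AE x in \<mu>. eventually (\<lambda>n. x \<in> space \<mu> - near_return (Suc n) (\<phi> (Suc n))) sequentially"
    by (intro borel_cantelli_AE1) (auto simp: emeasure_eq_measure)
  then have "AE x in \<mu>. x \<notin> recurrence_set L \<rho> a K \<phi>"
  proof (rule AE_mp, intro AE_I2 impI)
    fix x assume "eventually (\<lambda>n. x \<in> space \<mu> - near_return (Suc n) (\<phi> (Suc n))) sequentially"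
    then obtain N where "\<And>n. n \<ge> N \<Longrightarrow> x \<notin> near_return (Suc n) (\<phi> (Suc n))"
      by (auto simp: eventually_sequentially)
    then have "{n. x \<in> near_return (Suc n) (\<phi> (Suc n))} \<subseteq> {..<N}"
      by (force simp: not_less[symmetric])
    then show "x \<notin> recurrence_set L \<rho> a K \<phi>"
      unfolding recurrence_set_eq using finite_subset by auto
  qed
  then show ?thesis
    using recurrence_set_borel by (subst prob_eq_0) auto
qed

text \<open>The events \<open>B n\<close> keep only the times whose required prefix is at most as long as the time
  itself, as pairwise independence demands. The others have \<open>\<phi> (Suc n) powr similarity_dim\<close> at
  most \<open>L * (1 / L) ^ n\<close>, so convergence of the sum of the \<open>prob (B n)\<close> would force convergence of
  the given series.\<close>

lemma recurrence_full:
  assumes pos: "\<And>n. 1 \<le> n \<Longrightarrow> 0 < \<phi> n"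
    and div: "\<not> summable (\<lambda>n. \<phi> (Suc n) powr similarity_dim)"
  shows "prob (recurrence_set L \<rho> a K \<phi>) = 1"
proof -
  define k where "k n = level (\<phi> (Suc n))" for n
  define B where "B n = (if k n \<le> Suc n then coded (matches (Suc n) (k n)) else {})" for n
  have B_ev: "B n \<in> events" for n
    by (simp add: B_def matches_borel)
  have indep: "prob (B i \<inter> B j) \<le> prob (B i) * prob (B j)" if "i < j" for i j
    using that prob_matches_Int[of "k i" "Suc i" "Suc j" "k j"] by (auto simp: B_def)
  have B_div: "\<not> summable (\<lambda>n. prob (B n))"
  proof
    assume S: "summable (\<lambda>n. prob (B n))"
    \<comment> \<open>This rules out level \<open>0\<close>, where \<open>\<phi>\<close> is not controlled by the level but \<open>prob (B n) = 1\<close>.\<close>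
    have "eventually (\<lambda>n. prob (B n) < 1) sequentially"
      using summable_LIMSEQ_zero[OF S] by (rule order_tendstoD) simp
    then have "eventually (\<lambda>n. norm (\<phi> (Suc n) powr similarity_dim) \<le> L * prob (B n) + L * (1 / L) ^ n) sequentially"
    proof eventually_elim
      case (elim n)
      have pn: "0 < \<phi> (Suc n)" using pos by simp
      have k0: "0 < k n"
        using elim prob_matches[of "Suc n" 0] by (auto simp: B_def split: if_splits intro!: Nat.gr0I)
      have le: "\<phi> (Suc n) powr similarity_dim \<le> L / L ^ k n"
        using level_powr_ge[OF pn] k0 unfolding k_def by simp
      have nn: "0 \<le> L * (1 / L) ^ n" "0 \<le> L * prob (B n)" by auto
      show ?case
      proof (cases "k n \<le> Suc n")
        case True
        then have "L * prob (B n) = L / L ^ k n" by (simp add: B_def prob_matches)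
        with le nn(1) show ?thesis by (simp only: real_norm_def abs_of_nonneg powr_ge_zero)
      next
        case False
        have "L / L ^ k n \<le> L / L ^ n"
          using False L by (intro divide_left_mono of_nat_mono power_increasing) auto
        also have "\<dots> = L * (1 / L) ^ n" by (simp add: power_one_over)
        finally show ?thesis using le nn(2) by (simp only: real_norm_def abs_of_nonneg powr_ge_zero)
      qed
    qed
    moreover have "summable (\<lambda>n. L * prob (B n) + L * (1 / L) ^ n)"
      using L by (intro summable_add summable_mult S summable_geometric) auto
    ultimately have "summable (\<lambda>n. \<phi> (Suc n) powr similarity_dim)"
      by (rule summable_comparison_test_ev)
    with div show False by blast
  qed
  have "AE x in \<mu>. infinite {n. x \<in> B n}"
    using B_ev indep B_div by (rule pairwise_borel_cantelli)
  moreover have "AE x in \<mu>. x \<in> K"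
    using prob_K by (intro AE_prob_1) auto
  ultimately have "AE x in \<mu>. x \<in> recurrence_set L \<rho> a K \<phi>"
  proof eventually_elim
    case (elim x)
    have "B n \<subseteq> near_return (Suc n) (\<phi> (Suc n))" for n
      using coded_matches_subset_near_return[of "\<phi> (Suc n)" "Suc n"] pos by (auto simp: B_def k_def)
    then have "{n. x \<in> B n} \<subseteq> {n. x \<in> near_return (Suc n) (\<phi> (Suc n))}" by blast
    with elim show ?case unfolding recurrence_set_eq using infinite_super by auto
  qed
  then show ?thesis
    using recurrence_set_borel by (subst prob_eq_1) auto
qed

end

section \<open>Hausdorff dimension of the attractor\<close>

lemma diam_pow_le:
  assumes "bounded U" "diameter U \<le> d" "0 < s"
  shows "diam_pow s U \<le> ennreal (d powr s)"
  using assms diameter_ge_0[OF assms(1)] by (auto simp: diam_pow_def intro!: ennreal_leI powr_mono2)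

lemma diam_pow_ge:
  assumes "bounded U" "diameter U \<le> 1" "0 \<le> s" "s \<le> t"
  shows "ennreal (diameter U powr t) \<le> diam_pow s U"
proof (cases "s = 0")
  case True
  then show ?thesis
    using assms diameter_ge_0[OF assms(1)] by (auto simp: diam_pow_def powr_le1 intro: ennreal_leI)
next
  case False
  then show ?thesis
    using assms diameter_ge_0[OF assms(1)] by (auto simp: diam_pow_def intro!: ennreal_leI powr_mono')
qed

context self_similar_system
begin

lemma bounded_cyl: "bounded (cyl w N)"
  using compact_imp_bounded[OF compact_K] by (rule bounded_subset) (auto simp: cyl_def)

lemma diameter_cyl: "diameter (cyl w N) \<le> \<rho> ^ N"
proof (rule diameter_le)
  fix x y assume xy: "x \<in> cyl w N" "y \<in> cyl w N"
  then have K: "x \<in> K" "y \<in> K" by (auto simp: cyl_def)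
  show "norm (x - y) \<le> \<rho> ^ N"
    using addr_dist_le[OF coding_code_space[OF K(1)] coding_code_space[OF K(2)], of N] xy
    by (simp add: addr_coding K cyl_def)
qed (use rho_pos in auto)

lemma hausdorff_premeasure_cyl_cover:
  assumes "0 < s" "\<rho> ^ N \<le> \<delta>"
  shows "hausdorff_premeasure s \<delta> K \<le> ennreal ((L * \<rho> powr s) ^ N)"
proof -
  obtain h where h: "bij_betw h {0..<L ^ N} (words L N)"
    using ex_bij_betw_nat_finite[OF finite_words, of L N] by (auto simp: card_words)
  define U where "U i = (if i < L ^ N then cyl (h i) N else {})" for i
  have img: "words L N = h ` {0..<L ^ N}" using h by (simp add: bij_betw_def)
  have cover: "K \<subseteq> (\<Union>i. U i)"
    by (subst K_cyl_cover[of N]) (auto simp: img U_def)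
  have small: "bounded (U i) \<and> diameter (U i) \<le> \<delta>" for i
    using bounded_cyl diameter_cyl[of "h i" N] assms(2) zero_le_power[OF less_imp_le[OF rho_pos], of N]
    by (auto simp: U_def intro: order_trans simp del: zero_le_power)
  have "hausdorff_premeasure s \<delta> K \<le> (\<Sum>i. diam_pow s (U i))"
    unfolding hausdorff_premeasure_def using cover small by (intro INF_lower) auto
  also have "\<dots> = (\<Sum>i<L ^ N. diam_pow s (U i))"
    by (intro suminf_finite) (auto simp: U_def diam_pow_def)
  also have "\<dots> \<le> (\<Sum>i<L ^ N. ennreal ((\<rho> ^ N) powr s))"
    using bounded_cyl diameter_cyl assms(1) by (intro sum_mono) (auto simp: U_def intro!: diam_pow_le)
  also have "\<dots> = ennreal (L ^ N * (\<rho> ^ N) powr s)"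
    by (simp add: ennreal_mult ennreal_of_nat_eq_real_of_nat)
  also have "(\<rho> ^ N) powr s = (\<rho> powr s) ^ N"
    using rho_pos by (simp add: powr_power powr_realpow[symmetric] powr_powr mult.commute)
  finally show ?thesis by (simp add: power_mult_distrib)
qed

text \<open>The cover by the \<open>L ^ N\<close> cylinders of depth \<open>N\<close> contributes \<open>(L * \<rho> powr s) ^ N\<close>, and
  \<open>L * \<rho> powr s < 1\<close> above the similarity dimension.\<close>

lemma hausdorff_measure_K_zero:
  assumes "similarity_dim < s"
  shows "hausdorff_measure s K = 0"
proof -
  have s: "0 < s" using assms similarity_dim_pos by simp
  have "\<rho> powr s < \<rho> powr similarity_dim"
    using rho_pos rho_less assms by (intro powr_less_mono') auto
  also have "\<dots> = 1 / L" using rho_power_powr[of 1] by simp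
  finally have q: "L * \<rho> powr s < 1" using L by (simp add: field_simps)
  have "hausdorff_premeasure s \<delta> K = 0" if "0 < \<delta>" for \<delta>
  proof -
    have lim: "(\<lambda>N. ennreal ((L * \<rho> powr s) ^ N)) \<longlonglongrightarrow> ennreal 0"
      using q by (intro tendsto_ennrealI LIMSEQ_power_zero) auto
    obtain N0 where "\<rho> ^ N0 < \<delta>"
      using real_arch_pow_inv[OF \<open>0 < \<delta>\<close> rho_less] by blast
    then have "\<rho> ^ N \<le> \<delta>" if "N \<ge> N0" for N
      using power_decreasing[OF that less_imp_le[OF rho_pos] less_imp_le[OF rho_less]] by linarith
    then have "\<exists>N0. \<forall>N\<ge>N0. hausdorff_premeasure s \<delta> K \<le> ennreal ((L * \<rho> powr s) ^ N)"
      using hausdorff_premeasure_cyl_cover[OF s] by blast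
    with lim have "hausdorff_premeasure s \<delta> K \<le> ennreal 0"
      by (rule LIMSEQ_le_const)
    then show ?thesis by simp
  qed
  then show ?thesis unfolding hausdorff_measure_def by simp
qed

lemma cyl_coding_prob:
  assumes "x \<in> K"
  shows "cyl (coding L \<rho> a x) N \<in> sets borel" "prob (cyl (coding L \<rho> a x) N) = 1 / L ^ N"
  using cyl_compact_prob[of N "coding L \<rho> a x"] coding_code_space[OF assms] borel_compact
  by (auto simp: code_space_def)

lemma prob_point:
  assumes "x \<in> K"
  shows "prob {x} = 0"
proof -
  have le: "prob {x} \<le> (1 / L) ^ N" for N
  proof -
    have "{x} \<subseteq> cyl (coding L \<rho> a x) N" using assms by (simp add: cyl_def)
    then have "prob {x} \<le> prob (cyl (coding L \<rho> a x) N)"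
      using cyl_coding_prob(1)[OF assms] by (intro finite_measure_mono) (simp_all only: sets_mu)
    then show ?thesis unfolding cyl_coding_prob(2)[OF assms] by (simp add: power_one_over)
  qed
  have "(\<lambda>N. (1 / real L) ^ N) \<longlonglongrightarrow> 0"
    using L by (intro LIMSEQ_power_zero) auto
  then have "prob {x} \<le> 0" by (rule LIMSEQ_le_const) (use le in blast)
  then show ?thesis by (simp add: measure_le_0_iff)
qed

text \<open>A set of positive diameter \<open>d\<close> meets \<open>K\<close> inside a single cylinder: its points are closer
  than \<open>r = 2 * d\<close> to one another and therefore share \<open>level (r / gap)\<close> letters. The factor \<open>2\<close>
  makes the inequality strict. For diameter \<open>0\<close> the right-hand side is \<open>0\<close>, and points are null. The
  set \<open>C\<close> stands in for \<open>U \<inter> K\<close>, which need not be measurable.\<close>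

lemma mass_bound:
  assumes U: "bounded U"
  shows "\<exists>C\<in>sets borel. U \<inter> K \<subseteq> C \<and> prob C \<le> (2 / gap) powr similarity_dim * diameter U powr similarity_dim"
proof (cases "U \<inter> K = {}")
  case True
  then show ?thesis by (intro bexI[of _ "{}"]) auto
next
  case False
  then obtain x where x: "x \<in> U" "x \<in> K" by blast
  have dist: "\<bar>y - x\<bar> \<le> diameter U" if "y \<in> U" for y
    using diameter_bounded_bound[OF U that x(1)] by (simp add: dist_real_def)
  show ?thesis
  proof (cases "diameter U = 0")
    case True
    then have "U \<inter> K \<subseteq> {x}" using dist by fastforce
    then show ?thesis using True prob_point[OF x(2)] by (intro bexI[of _ "{x}"]) auto
  next
    case False
    then have pos: "0 < diameter U" using diameter_ge_0[OF U] by simp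
    define r where "r = 2 * diameter U"
    have "U \<inter> K \<subseteq> cyl (coding L \<rho> a x) (level (r / gap))"
    proof
      fix y assume y: "y \<in> U \<inter> K"
      then have "\<bar>y - x\<bar> < r" using dist[of y] pos by (simp add: r_def)
      with y x(2) show "y \<in> cyl (coding L \<rho> a x) (level (r / gap))"
        using close_points_share_prefix[of y x r] by (auto simp: cyl_def)
    qed
    moreover have "prob (cyl (coding L \<rho> a x) (level (r / gap))) \<le> (r / gap) powr similarity_dim"
      using level_powr_le[of "r / gap"] pos gap_pos by (simp add: cyl_coding_prob x r_def)
    moreover have "(r / gap) powr similarity_dim = (2 / gap) powr similarity_dim * diameter U powr similarity_dim"
      using pos gap_pos by (simp add: r_def powr_mult[symmetric])
    ultimately show ?thesis using cyl_coding_prob[OF x(2)] by auto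
  qed
qed

text \<open>Mass distribution principle: in a cover by sets of diameter at most \<open>1\<close>, total mass \<open>1\<close>
  forces the sum of the \<open>diameter (U i) powr similarity_dim\<close> to be at least \<open>1 / c\<close>, and passing to a
  smaller exponent only increases it.\<close>

lemma hausdorff_measure_K_nonzero:
  assumes s: "0 \<le> s" "s \<le> similarity_dim"
  shows "hausdorff_measure s K \<noteq> 0"
proof -
  define c where "c = (2 / gap) powr similarity_dim"
  have c: "0 < c" using gap_pos by (simp add: c_def)
  have "ennreal (1 / c) \<le> (\<Sum>i. diam_pow s (U i))"
    if cover: "K \<subseteq> (\<Union>i. U i)" and U: "\<forall>i. bounded (U i) \<and> diameter (U i) \<le> 1"
    for U :: "nat \<Rightarrow> real set"
  proof -
    have "\<forall>i. \<exists>C. C \<in> sets borel \<and> U i \<inter> K \<subseteq> C \<and> prob C \<le> c * diameter (U i) powr similarity_dim"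
      using mass_bound U unfolding c_def by blast
    then obtain C where C: "\<And>i. C i \<in> sets borel" "\<And>i. U i \<inter> K \<subseteq> C i"
      "\<And>i. prob (C i) \<le> c * diameter (U i) powr similarity_dim" by metis
    have "1 = emeasure \<mu> K" using prob_K by (simp add: emeasure_eq_measure)
    also have "\<dots> \<le> emeasure \<mu> (\<Union>i. C i)"
    proof (intro emeasure_mono)
      show "K \<subseteq> (\<Union>i. C i)" using cover C(2) by blast
    qed (use C(1) in auto)
    also have "\<dots> \<le> (\<Sum>i. emeasure \<mu> (C i))"
      using C by (intro emeasure_subadditive_countably) auto
    also have "\<dots> \<le> (\<Sum>i. ennreal c * diam_pow s (U i))"
    proof (intro suminf_le summableI)
      fix i
      have "emeasure \<mu> (C i) \<le> ennreal (c * diameter (U i) powr similarity_dim)"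
        using C(3) by (simp add: emeasure_eq_measure ennreal_leI)
      also have "\<dots> = ennreal c * ennreal (diameter (U i) powr similarity_dim)"
        using c by (simp add: ennreal_mult)
      also have "\<dots> \<le> ennreal c * diam_pow s (U i)"
        using U s by (intro mult_left_mono diam_pow_ge) auto
      finally show "emeasure \<mu> (C i) \<le> ennreal c * diam_pow s (U i)" .
    qed
    also have "\<dots> = ennreal c * (\<Sum>i. diam_pow s (U i))" by simp
    finally have "ennreal (1 / c) * 1 \<le> ennreal (1 / c) * (ennreal c * (\<Sum>i. diam_pow s (U i)))"
      by (intro mult_left_mono) auto
    also have "\<dots> = (\<Sum>i. diam_pow s (U i))"
      using c by (simp add: mult.assoc[symmetric] ennreal_mult[symmetric])
    finally show ?thesis by simp
  qed
  then have "ennreal (1 / c) \<le> hausdorff_premeasure s 1 K"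
    unfolding hausdorff_premeasure_def by (intro INF_greatest) auto
  also have "\<dots> \<le> hausdorff_measure s K"
    unfolding hausdorff_measure_def by (intro SUP_upper) auto
  finally show ?thesis using c by (auto simp: ennreal_eq_0_iff)
qed

lemma hausdorff_dim_K: "hausdorff_dim K = similarity_dim"
proof -
  define S where "S = {s. 0 \<le> s \<and> hausdorff_measure s K = 0}"
  have above: "s \<in> S" if "similarity_dim < s" for s
    using that hausdorff_measure_K_zero similarity_dim_pos by (simp add: S_def)
  have below: "similarity_dim \<le> s" if "s \<in> S" for s
    using that hausdorff_measure_K_nonzero[of s] by (force simp: S_def)
  have "Inf S \<le> s" if "similarity_dim < s" for s
    using above[OF that] below by (intro cInf_lower) (auto simp: bdd_below_def)
  then have "Inf S \<le> similarity_dim" by (rule dense_ge)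
  moreover have "similarity_dim \<le> Inf S"
    using above[of "similarity_dim + 1"] below by (intro cInf_greatest) auto
  ultimately show ?thesis by (simp add: hausdorff_dim_def S_def)
qed

end

section \<open>The zero-one law for recurrence\<close>

theorem theorem1p3:
  fixes L :: nat and \<rho> :: real and a :: "nat \<Rightarrow> real" and K :: "real set"
    and \<mu> :: "real measure" and \<gamma> :: real and \<phi> :: "nat \<Rightarrow> real"
  assumes "2 \<le> L" and "0 < \<rho>" and "\<rho> < 1"
    and "0 \<le> a 1" and "strict_mono_on {1..L} a" and "a L \<le> 1 - \<rho>"
    and "is_attractor L \<rho> a K"
    and "strong_separation L \<rho> a K"
    and "is_self_similar_measure L \<rho> a K \<mu>"
    and "\<gamma> = hausdorff_dim K"
    and "\<And>n. 1 \<le> n \<Longrightarrow> 0 < \<phi> n"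
  shows "\<gamma> = ln (real L) / (- ln \<rho>) \<and>
    recurrence_set L \<rho> a K \<phi> \<in> sets \<mu> \<and>
    (summable (\<lambda>n. \<phi> (Suc n) powr \<gamma>) \<longrightarrow> measure \<mu> (recurrence_set L \<rho> a K \<phi>) = 0) \<and>
    (\<not> summable (\<lambda>n. \<phi> (Suc n) powr \<gamma>) \<longrightarrow> measure \<mu> (recurrence_set L \<rho> a K \<phi>) = 1)"
proof -
  have "0 \<le> a j \<and> a j \<le> 1 - \<rho>" if "j \<in> {1..L}" for j
  proof -
    have "mono_on {1..L} a" using assms(5) by (rule strict_mono_on_imp_mono_on)
    then have "a 1 \<le> a j" "a j \<le> a L"
      using that assms(1) by (auto elim!: mono_onD)
    with assms(4,6) show ?thesis by linarith
  qed
  then interpret self_similar_system L \<rho> a K \<mu>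
    using assms by unfold_locales auto
  have \<gamma>: "\<gamma> = similarity_dim" using assms(10) hausdorff_dim_K by simp
  show ?thesis
    using recurrence_set_borel recurrence_null[of \<phi>, OF assms(11)]
      recurrence_full[of \<phi>, OF assms(11)]
    unfolding \<gamma> by (auto simp: similarity_dim_def)
qed

end
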